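(* Let $F\in C^2(\mathbb{R};\mathbb{R}^N)$, $f=F'$, let $u_0^\pm\in C^1(\mathbb{R}^N)$ have compact support, let $T>0$ be small enough, and let $u^\pm\in C^1(\mathbb{R}^N\times[0,T])$ be the classical solutions of $$\partial_t u^\pm+f(u^\pm)\cdot\nabla u^\pm=0\ \text{ in }\mathbb{R}^N\times(0,T),\qquad u^\pm(\cdot,0)=u_0^\pm .$$ Let $\mathbf{u}^\pm$ be a network minimizer of $\boldsymbol{\mathcal{L}}^\pm$ in $\mathbf{N}_A$, i.e. $\mathbf{u}^\pm=\operatorname{argmin}\{\boldsymbol{\mathcal{L}}^\pm[\mathbf{u}]:\ \mathbf{u}\in\mathbf{N}_A\}$, and consider $(\boldsymbol{\varepsilon}^\pm_i,\boldsymbol{\varepsilon}^\pm_b)\in C^\infty(\mathbb{R}^N\times\mathbb{R})\times C^\infty(\mathbb{R}^N)$ defined by $$\boldsymbol{\varepsilon}_i^\pm=\partial_t\mathbf{u}^\pm+f(\mathbf{u}^\pm)\cdot\nabla\mathbf{u}^\pm,\qquad \boldsymbol{\varepsilon}_b^\pm=\mathbf{u}^\pm(\cdot,0)-u_0^\pm .$$ Then $e^\pm=\mathbf{u}^\pm-u^\pm$ satisfies $$\|e^\pm\|_{L^\infty(\mathbb{R}^N\times[0,T])}\le\Big(\|\boldsymbol{\varepsilon}_b^\pm\|_{L^\infty(\mathbb{R}^N)}+T\|\boldsymbol{\varepsilon}_i^\pm\|_{L^\infty(\mathbb{R}^N\times[0,T])}\Big)\exp\Big(T\,\|f'\|_{L^\infty(B(0,\rho_0^\pm+\boldsymbol{\rho}_0^\pm))}\,\rho_1^\pm\Big),$$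 where $$\rho_0^\pm=\|u_0^\pm\|_{L^\infty(\mathbb{R}^N)},\qquad \boldsymbol{\rho}_0^\pm=\|u_0^\pm\|_{L^\infty(\mathbb{R}^N)}+\|\boldsymbol{\varepsilon}_b^\pm\|_{L^\infty(\mathbb{R}^N)}+T\|\boldsymbol{\varepsilon}_i^\pm\|_{L^\infty(\mathbb{R}^N\times[0,T])},$$ $$\rho_1^\pm=\|\nabla u_0^\pm\|_{L^\infty(\mathbb{R}^N)}+C^\pm\|f'\|_{L^\infty(B(0,\rho_0^\pm))},$$ and $C^\pm$ is a constant for which the a priori gradient bound $\|\nabla u^\pm\|_{L^\infty(\mathbb{R}^N\times[0,T])}\le\rho_1^\pm$ holds.
   Context: $T$ is small enough that the classical $C^1$ solutions $u^\pm$ exist on $[0,T]$. $B(0,\rho)$ is the ball of $\mathbb{R}$ of radius $\rho$ centered at $0$; $\nabla$ is the gradient in $x\in\mathbb{R}^N$; $|\cdot|$ is the Euclidean norm for vector-valued functions. The statement is understood for each sign $+$ and $-$ separately. Neural networks. An architecture $A=[n_0,n_1,\ldots,n_l]$ has $n_0=N+1$ inputs $(x,t)=(x_1,\ldots,x_N,t)$ and $n_l=1$ output. Its parameters are $\theta=(\theta^1,\ldots,\theta^l)$, $\theta^i=(w^i,b^i)$, with $w^i\in\mathbb{R}^{n_i\times n_{i-1}}$ and $b^i\in\mathbb{R}^{n_i}$. The corresponding network function is $$\mathbf{u}(\theta;y)=w^l\cdot\sigma\big(w^{l-1}\cdot(\cdots\sigma(w^2\cdot\sigma(w^1\cdot y+b^1)+b^2)\cdots)+b^{l-1}\big)+b^l,\qquad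 y=(x,t),$$ with a smooth nonlinear activation function $\sigma:\mathbb{R}\to\mathbb{R}$ applied componentwise. $\mathbf{N}_A$ is the set of all such network functions. Loss. For fixed $k,m\in\mathbb{N}_0$ and $\mathbf{u}\in\mathbf{N}_A$, put $L_i^\pm[\mathbf{u}]=\partial_t\mathbf{u}+f(\mathbf{u})\cdot\nabla\mathbf{u}$, $L_b^\pm[\mathbf{u}]=\mathbf{u}(\cdot,0)-u_0^\pm$, and $$\boldsymbol{\mathcal{L}}^\pm[\mathbf{u}]=\sum_{\alpha\in\mathbb{N}_0^N,\ \beta\in\mathbb{N}_0,\ |\alpha|+\beta\le k}\int_0^T\!\!\int_{\mathbb{R}^N}|D_x^\alpha D_t^\beta L_i^\pm[\mathbf{u}]|^2\,dx\,dt+\sum_{\alpha\in\mathbb{N}_0^N,\ |\alpha|\le m}\int_{\mathbb{R}^N}|D_x^\alpha L_b^\pm[\mathbf{u}]|^2\,dx .$$ The minimization is over the parameters $\theta$. *)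

theory Defs
  imports
    "HOL-Probability.Essential_Supremum"
    "Jordan_Normal_Form.Matrix"
begin

(* Matrix reuses symbols that here denote the inner product and the components of real^'n. *)
no_notation scalar_prod (infix "\<bullet>" 70)
no_notation vec_index (infixl "$" 100)

section \<open>Calculus\<close>

text \<open>
  The space-time variable is a pair \<open>(x, t)\<close> of type \<open>(real ^ 'n) \<times> real\<close>, with
  \<open>N = CARD('n)\<close>. All derivatives are taken within a set \<open>S\<close>. They are used
  only for \<open>S\<close> open or \<open>S\<close> the closed strip \<open>\<real>\<^sup>N \<times> [0, T]\<close> with \<open>T > 0\<close>, where the derivative
  within \<open>S\<close> is unique (one-sided in time at \<open>t = 0\<close> and \<open>t = T\<close>).
\<close>

definition partial :: "'a::euclidean_space set \<Rightarrow> 'a \<Rightarrow> ('a \<Rightarrow> 'b::real_normed_vector) \<Rightarrow> 'a \<Rightarrow> 'b"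
  where "partial S d g p = frechet_derivative g (at p within S) d"

primrec Ck_on :: "nat \<Rightarrow> 'a::euclidean_space set \<Rightarrow> ('a \<Rightarrow> 'b::real_normed_vector) \<Rightarrow> bool"
  where
    "Ck_on 0 S g \<longleftrightarrow> continuous_on S g"
  | "Ck_on (Suc r) S g \<longleftrightarrow> g differentiable_on S \<and> (\<forall>d\<in>Basis. Ck_on r S (partial S d g))"

definition smooth :: "('a::euclidean_space \<Rightarrow> 'b::real_normed_vector) \<Rightarrow> bool"
  where "smooth g \<longleftrightarrow> (\<forall>r. Ck_on r UNIV g)"

definition grad :: "(real ^ 'n \<Rightarrow> real) \<Rightarrow> real ^ 'n \<Rightarrow> real ^ 'n"
  where "grad g x = (\<chi> i. partial UNIV (axis i 1) g x)"

definition grad_x :: "((real ^ 'n) \<times> real) set \<Rightarrow> ((real ^ 'n) \<times> real \<Rightarrow> real) \<Rightarrow> (real ^ 'n) \<times> real \<Rightarrow> real ^ 'n"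
  where "grad_x S g p = (\<chi> i. partial S (axis i 1, 0) g p)"

definition d_t :: "((real ^ 'n) \<times> real) set \<Rightarrow> ((real ^ 'n) \<times> real \<Rightarrow> real) \<Rightarrow> (real ^ 'n) \<times> real \<Rightarrow> real"
  where "d_t S g p = partial S (0, 1) g p"

text \<open>
  The \<open>j\<close>-th coordinate index, for \<open>j < CARD('n)\<close>. The enumeration is arbitrary. It fixes the order
  of the partial derivatives in \<open>D\<^sup>\<alpha>\<close> (which is immaterial for \<open>C\<^sup>k\<close> functions) and the order of
  the network inputs (which only permutes the columns of the first weight matrix).
\<close>

definition coord :: "nat \<Rightarrow> 'n::finite"
  where "coord = from_nat_into UNIV"

text \<open>\<open>D\<^sup>\<alpha>\<close>, where \<open>e i\<close> is the direction of the \<open>i\<close>-th space coordinate in the domain of \<open>g\<close>.\<close>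

definition D_multi ::
    "'a::euclidean_space set \<Rightarrow> ('n::finite \<Rightarrow> 'a) \<Rightarrow> ('n \<Rightarrow> nat) \<Rightarrow> ('a \<Rightarrow> real) \<Rightarrow> 'a \<Rightarrow> real"
  where "D_multi S e \<alpha> g = fold (\<lambda>j. partial S (e (coord j)) ^^ \<alpha> (coord j)) [0..<CARD('n)] g"

section \<open>Sup-norms\<close>

text \<open>
  The \<open>L\<^sup>\<infinity>(S)\<close> norm with respect to Lebesgue measure, possibly infinite. The essential supremum is
  formed in the nonnegative extended reals, so the norm over a null set is \<open>0\<close>.
\<close>

definition Linf_norm :: "'a::euclidean_space set \<Rightarrow> ('a \<Rightarrow> 'b::real_normed_vector) \<Rightarrow> ereal"
  where "Linf_norm S g = enn2ereal (esssup (restrict_space lborel S) (\<lambda>x. ennreal (norm (g x))))"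

definition ball0 :: "ereal \<Rightarrow> real set"
  where "ball0 \<rho> = {s. ereal \<bar>s\<bar> < \<rho>}"

definition exp_ereal :: "ereal \<Rightarrow> ereal"
  where "exp_ereal x = (case x of ereal r \<Rightarrow> ereal (exp r) | PInfty \<Rightarrow> \<infinity> | MInfty \<Rightarrow> 0)"

section \<open>The conservation law\<close>

definition strip :: "real \<Rightarrow> ((real ^ 'n) \<times> real) set"
  where "strip T = UNIV \<times> {0..T}"

definition classical_solution ::
    "(real \<Rightarrow> real ^ 'n) \<Rightarrow> real \<Rightarrow> (real ^ 'n \<Rightarrow> real) \<Rightarrow> ((real ^ 'n) \<times> real \<Rightarrow> real) \<Rightarrow> bool"
  where "classical_solution f T u0 u \<longleftrightarrow>
    Ck_on 1 (strip T) u \<and>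
    (\<forall>x. \<forall>t\<in>{0<..<T}. d_t (strip T) u (x, t) + f (u (x, t)) \<bullet> grad_x (strip T) u (x, t) = 0) \<and>
    (\<forall>x. u (x, 0) = u0 x)"

definition L_i :: "(real \<Rightarrow> real ^ 'n) \<Rightarrow> ((real ^ 'n) \<times> real \<Rightarrow> real) \<Rightarrow> (real ^ 'n) \<times> real \<Rightarrow> real"
  where "L_i f v p = d_t UNIV v p + f (v p) \<bullet> grad_x UNIV v p"

definition L_b :: "(real ^ 'n \<Rightarrow> real) \<Rightarrow> ((real ^ 'n) \<times> real \<Rightarrow> real) \<Rightarrow> real ^ 'n \<Rightarrow> real"
  where "L_b u0 v x = v (x, 0) - u0 x"

section \<open>Neural networks\<close>

fun net_eval :: "(real \<Rightarrow> real) \<Rightarrow> (real mat \<times> real Matrix.vec) list \<Rightarrow> real Matrix.vec \<Rightarrow> real Matrix.vec"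
  where
    "net_eval \<sigma> [] y = y"
  | "net_eval \<sigma> [(w, b)] y = w *\<^sub>v y + b"
  | "net_eval \<sigma> ((w, b) # \<theta>) y = net_eval \<sigma> \<theta> (map_vec \<sigma> (w *\<^sub>v y + b))"

definition net_input :: "(real ^ 'n) \<times> real \<Rightarrow> real Matrix.vec"
  where "net_input p =
    Matrix.vec (CARD('n) + 1) (\<lambda>j. if j < CARD('n) then fst p $ coord j else snd p)"

definition net_params :: "nat list \<Rightarrow> (real mat \<times> real Matrix.vec) list set"
  where "net_params A = {\<theta>. length A = Suc (length \<theta>) \<and>
    (\<forall>i<length \<theta>. fst (\<theta> ! i) \<in> carrier_mat (A ! Suc i) (A ! i) \<and>
                   snd (\<theta> ! i) \<in> carrier_vec (A ! Suc i))}"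

definition networks :: "(real \<Rightarrow> real) \<Rightarrow> nat list \<Rightarrow> ((real ^ 'n) \<times> real \<Rightarrow> real) set"
  where "networks \<sigma> A = {\<lambda>p. vec_index (net_eval \<sigma> \<theta> (net_input p)) 0 | \<theta>. \<theta> \<in> net_params A}"

section \<open>The loss\<close>

text \<open>
  The loss takes values in \<open>[0, \<infinity>]\<close>: the integrals may diverge, and the value is \<open>\<infinity>\<close> when the data
  are not regular enough for the derivatives in it to exist (possible only if \<open>k\<close> exceeds the
  regularity of \<open>f\<close>, or \<open>m\<close> that of \<open>u0\<close>).
\<close>

definition loss ::
    "(real \<Rightarrow> real ^ 'n) \<Rightarrow> real \<Rightarrow> (real ^ 'n \<Rightarrow> real) \<Rightarrow> nat \<Rightarrow> nat
      \<Rightarrow> ((real ^ 'n) \<times> real \<Rightarrow> real) \<Rightarrow> ennreal"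
  where "loss f T u0 k m v =
    (let \<Omega> = UNIV \<times> {0<..<T} in
     if Ck_on k \<Omega> (L_i f v) \<and> Ck_on m UNIV (L_b u0 v) then
       (\<Sum>(\<alpha>, \<beta>) \<in> {(\<alpha> :: 'n \<Rightarrow> nat, \<beta> :: nat). sum \<alpha> UNIV + \<beta> \<le> k}.
          \<integral>\<^sup>+ t\<in>{0<..<T}. (\<integral>\<^sup>+ x.
            ennreal ((D_multi \<Omega> (\<lambda>i. (axis i 1, 0)) \<alpha> ((partial \<Omega> (0, 1) ^^ \<beta>) (L_i f v)) (x, t))\<^sup>2)
          \<partial>lborel) \<partial>lborel) +
       (\<Sum>\<alpha> \<in> {\<alpha> :: 'n \<Rightarrow> nat. sum \<alpha> UNIV \<le> m}.
          \<integral>\<^sup>+ x. ennreal ((D_multi UNIV (\<lambda>i. axis i 1) \<alpha> (L_b u0 v) x)\<^sup>2) \<partial>lborel)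
     else \<infinity>)"

end

(*
  The proof avoids solving the characteristic ODE. On a backward cone whose slope bounds the speed
  f(U), a point of positive time can always be moved a little backwards in time along the
  characteristic direction (f(U), 1) without leaving the cone. Extremality on this compact cone
  therefore yields sup-norm bounds first for u and U, where the slope of the cone has to be fixed
  before U is known to be bounded, and then for e = U - u, which satisfies
    de/dt + f(U) . grad e = eps_i - (f(U) - f(u)) . grad u,
  so that a weight exp(-L t) with L = |f'| |grad u| replaces Gronwall's lemma.
*)

theory Submission
  imports Defs
begin

section \<open>Transport inequalities without characteristics\<close>

text \<open>The chain rule along a line run backwards in time with velocity -(a, 1). It turns the
  sign of \<open>D (a, 1)\<close> into a comparison with slightly earlier points.\<close>

lemma DERIV_backward_line:
  fixes v :: "'a::real_normed_vector \<times> real \<Rightarrow> real"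
  assumes "(v has_derivative D) (at (x, t))"
  shows "((\<lambda>h. v (x - h *\<^sub>R a, t - h)) has_real_derivative - D (a, 1)) (at 0)"
proof -
  interpret D: bounded_linear D
    using assms by (rule has_derivative_bounded_linear)
  have "((\<lambda>h. (x - h *\<^sub>R a, t - h)) has_derivative (\<lambda>h. (- (h *\<^sub>R a), - h))) (at 0)"
    by (auto intro!: derivative_eq_intros)
  then have "((\<lambda>h. v (x - h *\<^sub>R a, t - h)) has_derivative (\<lambda>h. D (- (h *\<^sub>R a), - h))) (at 0)"
    using has_derivative_compose[of "\<lambda>h. (x - h *\<^sub>R a, t - h)" _ 0 UNIV v D] assms by simp
  moreover have "D (- (h *\<^sub>R a), - h) = - D (a, 1) * h" for h
    using D.scaleR[of "-h" "(a, 1)"] by (simp add: mult.commute)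
  ultimately show ?thesis
    by (simp only: has_field_derivative_def)
qed

text \<open>The domain of dependence of (x, t) for speeds up to V. The enclosing product makes it
  bounded whatever the sign of V.\<close>

definition backward_cone :: "'a::euclidean_space \<Rightarrow> real \<Rightarrow> real \<Rightarrow> ('a \<times> real) set"
  where "backward_cone x t V = {p \<in> cball x (V * t) \<times> {0..t}. dist (fst p) x \<le> V * (t - snd p)}"

lemma compact_backward_cone: "compact (backward_cone x t V)"
proof -
  have "closed (backward_cone x t V)"
    unfolding backward_cone_def
    by (intro continuous_on_closed_Collect_le continuous_intros closed_Times) auto
  moreover have "bounded (backward_cone x t V)"
    by (rule bounded_subset[of "cball x (V * t) \<times> {0..t}"])
      (auto simp: backward_cone_def intro!: bounded_Times)
  ultimately show ?thesis
    by (simp add: compact_eq_bounded_closed)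
qed

lemma apex_mem_backward_cone: "0 \<le> t \<Longrightarrow> 0 \<le> V \<Longrightarrow> (x, t) \<in> backward_cone x t V"
  by (simp add: backward_cone_def)

text \<open>Moving by at most h V in space while going back by h in time is exactly what the
  widening of the cone allows; h <= s keeps the time nonnegative.\<close>

lemma backward_cone_step:
  assumes p: "(y, s) \<in> backward_cone x t V" and a: "norm a \<le> V" and h: "0 \<le> h" "h \<le> s"
  shows "(y - h *\<^sub>R a, s - h) \<in> backward_cone x t V"
proof -
  have V: "0 \<le> V"
    using a norm_ge_zero[of a] by linarith
  have "dist (y - h *\<^sub>R a) x \<le> dist y x + norm (h *\<^sub>R a)"
    using norm_triangle_ineq4[of "y - x" "h *\<^sub>R a"] by (simp add: dist_norm algebra_simps)
  also have "\<dots> \<le> V * (t - s) + h * V"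
    using p a h by (intro add_mono) (auto simp: backward_cone_def intro: mult_left_mono)
  finally have "dist (y - h *\<^sub>R a) x \<le> V * (t - (s - h))"
    by (simp add: algebra_simps)
  moreover have "V * (t - (s - h)) \<le> V * t"
    using V h by (intro mult_left_mono) auto
  ultimately show ?thesis
    using p h by (auto simp: backward_cone_def dist_commute)
qed

text \<open>
  \<open>G\<close> contains the backward characteristic from \<open>(x, t)\<close>, if there is one. Its point of least time
  lies at time \<open>0\<close>, as otherwise a short step backwards along \<open>(f (v p), 1)\<close> would stay in \<open>G\<close>.
\<close>

lemma transport_bound:
  fixes v :: "'a::euclidean_space \<times> real \<Rightarrow> real" and f :: "real \<Rightarrow> 'a"
  assumes f: "continuous_on UNIV f"
    and v: "continuous_on (UNIV \<times> {0..<T}) v"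
    and der: "\<And>x t. 0 < t \<Longrightarrow> t < T \<Longrightarrow> (v has_derivative D (x, t)) (at (x, t))"
    and src: "\<And>x t. 0 < t \<Longrightarrow> t < T \<Longrightarrow> \<bar>D (x, t) (f (v (x, t)), 1)\<bar> \<le> E"
    and E: "0 \<le> E"
    and init: "\<And>x. \<bar>v (x, 0)\<bar> \<le> B"
    and t: "0 \<le> t" "t < T"
  shows "\<bar>v (x, t)\<bar> \<le> B + t * E"
proof (rule field_le_epsilon)
  fix \<epsilon> :: real assume \<epsilon>: "0 < \<epsilon>"
  \<comment> \<open>The slack \<delta> makes the later inequalities strict; the denominator t + 1
    also covers t = 0.\<close>
  define \<delta> where "\<delta> = \<epsilon> / (t + 1)"
  have \<delta>: "0 < \<delta>" "t * \<delta> \<le> \<epsilon>"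
    using t \<epsilon> by (auto simp: \<delta>_def field_simps)
  define c where "c = v (x, t)"
  \<comment> \<open>On the set \<open>G\<close> below, \<open>v\<close> stays within t (E +
    \<delta>) of its apex value \<open>c\<close>. Hence the compact image of this interval bounds
    the speed on \<open>G\<close>, although \<open>v\<close> is not yet known to be bounded.\<close>
  have "compact (f ` cball c (t * (E + \<delta>)))"
    by (intro compact_continuous_image continuous_on_subset[OF f]) auto
  then obtain V where V: "\<And>s. \<bar>s - c\<bar> \<le> t * (E + \<delta>) \<Longrightarrow> norm (f s) \<le> V" "0 < V"
    by (force dest!: compact_imp_bounded simp: bounded_pos dist_real_def abs_minus_commute)
  \<comment> \<open>Admits a drift from the apex value of at most E + \<delta> per unit of elapsed
    time.\<close>
  define G where "G = {p \<in> backward_cone x t V. \<bar>v p - c\<bar> \<le> (t - snd p) * (E + \<delta>)}"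
  have sub: "backward_cone x t V \<subseteq> UNIV \<times> {0..<T}"
    using t by (auto simp: backward_cone_def)
  have "closed G"
    unfolding G_def
    by (intro continuous_on_closed_Collect_le continuous_intros continuous_on_subset[OF v sub]
        compact_imp_closed compact_backward_cone)
  then have "compact G"
    using compact_Int_closed[OF compact_backward_cone, of G x t V]
    by (simp add: G_def inf.absorb2 Int_def conj_commute)
  moreover have "(x, t) \<in> G"
    using t V(2) by (auto simp: G_def c_def intro: apex_mem_backward_cone)
  moreover have "continuous_on G snd"
    by (intro continuous_intros)
  ultimately obtain p where p: "p \<in> G" and min: "\<And>q. q \<in> G \<Longrightarrow> snd p \<le> snd q"
    using continuous_attains_inf[of G snd] by blast
  obtain y s where ys: "p = (y, s)"
    by (cases p)
  have s: "0 \<le> s" "s \<le> t"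
    using p by (auto simp: ys G_def backward_cone_def)
  have close: "\<bar>v (y, s) - c\<bar> \<le> (t - s) * (E + \<delta>)"
    using p by (auto simp: ys G_def)
  have "s = 0"
  proof (rule ccontr)
    assume "s \<noteq> 0"
    with s have s0: "0 < s" "s < T"
      using t by auto
    define a where "a = f (v (y, s))"
    define g where "g h = v (y - h *\<^sub>R a, s - h)" for h
    have g: "(g has_real_derivative - D (y, s) (a, 1)) (at 0)"
      unfolding g_def by (rule DERIV_backward_line[OF der[OF s0]])
    have src': "\<bar>D (y, s) (a, 1)\<bar> \<le> E"
      unfolding a_def by (rule src[OF s0])
    \<comment> \<open>Since the derivative of \<open>g\<close> at 0 has absolute value at most E,
      this one is negative and the next one positive. Together they bound the drift over a short
      step by h (E + \<delta>).\<close>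
    have "((\<lambda>h. g h - h * (E + \<delta>)) has_real_derivative - D (y, s) (a, 1) - (E + \<delta>)) (at 0)"
      by (auto intro!: derivative_eq_intros g)
    from DERIV_neg_dec_right[OF this] obtain d1
      where d1: "d1 > 0" "\<And>h. 0 < h \<Longrightarrow> h < d1 \<Longrightarrow> g h - h * (E + \<delta>) < g 0"
      using src' \<delta> by (auto simp: abs_le_iff)
    have "((\<lambda>h. g h + h * (E + \<delta>)) has_real_derivative - D (y, s) (a, 1) + (E + \<delta>)) (at 0)"
      by (auto intro!: derivative_eq_intros g)
    from DERIV_pos_inc_right[OF this] obtain d2
      where d2: "d2 > 0" "\<And>h. 0 < h \<Longrightarrow> h < d2 \<Longrightarrow> g 0 < g h + h * (E + \<delta>)"
      using src' \<delta> by (auto simp: abs_le_iff)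
    define h where "h = min s (min d1 d2) / 2"
    have h: "0 < h" "h \<le> s" "h < d1" "h < d2"
      using s0 d1 d2 by (auto simp: h_def)
    have "\<bar>g h - g 0\<bar> \<le> h * (E + \<delta>)"
      using d1(2)[OF h(1,3)] d2(2)[OF h(1,4)] by linarith
    then have "\<bar>g h - c\<bar> \<le> (t - (s - h)) * (E + \<delta>)"
      using close by (simp add: g_def algebra_simps)
    moreover have "norm a \<le> V"
    proof -
      have "(t - s) * (E + \<delta>) \<le> t * (E + \<delta>)"
        using s E \<delta> by (intro mult_right_mono) auto
      then show ?thesis
        unfolding a_def using close by (intro V(1)) linarith
    qed
    ultimately have "(y - h *\<^sub>R a, s - h) \<in> G"
      using p h by (auto simp: G_def ys g_def intro: backward_cone_step)
    from min[OF this] show False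
      using h by (simp add: ys)
  qed
  \<comment> \<open>At time 0 the drift is at most t (E + \<delta>) and the initial bound
    applies.\<close>
  then have "\<bar>c\<bar> \<le> B + t * (E + \<delta>)"
    using close init[of y] by simp
  also have "\<dots> \<le> B + t * E + \<epsilon>"
    using \<delta> by (simp add: algebra_simps)
  finally show "\<bar>v (x, t)\<bar> \<le> B + t * E + \<epsilon>"
    by (simp add: c_def)
qed

text \<open>A value above B at the apex would put the maximum over the compact cone at a positive
  time. There \<phi> decreases along (a, 1), so a short step backwards increases it without leaving
  the cone. The sign condition concerns only points with \<phi> > B, and \<open>a\<close> may be
  discontinuous.\<close>

lemma transport_maximum_principle:
  fixes \<phi> :: "'a::euclidean_space \<times> real \<Rightarrow> real" and a :: "'a \<times> real \<Rightarrow> 'a"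
  assumes \<phi>: "continuous_on (UNIV \<times> {0..<T}) \<phi>"
    and der: "\<And>x t. 0 < t \<Longrightarrow> t < T \<Longrightarrow> (\<phi> has_derivative D (x, t)) (at (x, t))"
    and neg: "\<And>x t. 0 < t \<Longrightarrow> t < T \<Longrightarrow> B < \<phi> (x, t) \<Longrightarrow> D (x, t) (a (x, t), 1) < 0"
    and a: "\<And>x t. 0 < t \<Longrightarrow> t < T \<Longrightarrow> norm (a (x, t)) \<le> V" and V: "0 \<le> V"
    and init: "\<And>x. \<phi> (x, 0) \<le> B"
    and t: "0 \<le> t" "t < T"
  shows "\<phi> (x, t) \<le> B"
proof (rule ccontr)
  assume "\<not> \<phi> (x, t) \<le> B"
  have apex: "(x, t) \<in> backward_cone x t V"
    using t V by (rule_tac apex_mem_backward_cone)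
  have "continuous_on (backward_cone x t V) \<phi>"
    by (rule continuous_on_subset[OF \<phi>]) (use t in \<open>auto simp: backward_cone_def\<close>)
  then obtain p where p: "p \<in> backward_cone x t V"
    and max: "\<And>q. q \<in> backward_cone x t V \<Longrightarrow> \<phi> q \<le> \<phi> p"
    using continuous_attains_sup[OF compact_backward_cone] apex by (metis empty_iff)
  obtain y s where ys: "p = (y, s)"
    by (cases p)
  have big: "B < \<phi> (y, s)"
    using max[OF apex] \<open>\<not> \<phi> (x, t) \<le> B\<close> by (simp add: ys)
  have "0 \<le> s" "s \<le> t"
    using p by (auto simp: ys backward_cone_def)
  moreover have "s \<noteq> 0"
    using big init[of y] by auto
  ultimately have s: "0 < s" "s < T"
    using t by auto
  define g where "g h = \<phi> (y - h *\<^sub>R a (y, s), s - h)" for h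
  have "(g has_real_derivative - D (y, s) (a (y, s), 1)) (at 0)"
    unfolding g_def by (rule DERIV_backward_line[OF der[OF s]])
  from DERIV_pos_inc_right[OF this] neg[OF s big] obtain d
    where d: "d > 0" "\<And>h. 0 < h \<Longrightarrow> h < d \<Longrightarrow> g 0 < g h"
    by auto
  define h where "h = min s d / 2"
  have h: "0 < h" "h \<le> s" "h < d"
    using s d by (auto simp: h_def)
  have "\<phi> (y - h *\<^sub>R a (y, s), s - h) \<le> \<phi> p"
    by (intro max backward_cone_step) (use p h a[OF s] in \<open>auto simp: ys\<close>)
  then show False
    using d(2)[OF h(1,3)] by (simp add: g_def ys)
qed

text \<open>A Gronwall bound for the difference: the weight exp(-L t) absorbs the term with L, and a
  linear function of time absorbs E. Both functions are differentiated along the same direction (a,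
  1).\<close>

lemma transport_difference_bound:
  fixes u v :: "'a::euclidean_space \<times> real \<Rightarrow> real" and f :: "real \<Rightarrow> 'a"
  assumes u: "continuous_on (UNIV \<times> {0..<T}) u"
    and v: "continuous_on (UNIV \<times> {0..<T}) v"
    and der_u: "\<And>x t. 0 < t \<Longrightarrow> t < T \<Longrightarrow> (u has_derivative Du (x, t)) (at (x, t))"
    and der_v: "\<And>x t. 0 < t \<Longrightarrow> t < T \<Longrightarrow> (v has_derivative Dv (x, t)) (at (x, t))"
    and eq: "\<And>x t. 0 < t \<Longrightarrow> t < T \<Longrightarrow> \<bar>Dv (x, t) (a (x, t), 1) - Du (x, t) (a (x, t), 1)\<bar>
      \<le> E + L * \<bar>v (x, t) - u (x, t)\<bar>"
    and a: "\<And>x t. 0 < t \<Longrightarrow> t < T \<Longrightarrow> norm (a (x, t)) \<le> V" and V: "0 \<le> V"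
    and E: "0 \<le> E" and L: "0 \<le> L"
    and init: "\<And>x. \<bar>v (x, 0) - u (x, 0)\<bar> \<le> B"
    and t: "0 \<le> t" "t < T"
  shows "\<bar>v (x, t) - u (x, t)\<bar> \<le> (B + t * E) * exp (L * t)"
proof -
  have B: "0 \<le> B"
    using init[of x] by linarith
  \<comment> \<open>Used with v - u and with u - v, so that only upper bounds for the directional
    derivative enter.\<close>
  have one_sided: "w (x, t) \<le> (B + t * E) * exp (L * t)"
    if w: "continuous_on (UNIV \<times> {0..<T}) w"
      and der: "\<And>x t. 0 < t \<Longrightarrow> t < T \<Longrightarrow> (w has_derivative D (x, t)) (at (x, t))"
      and eq: "\<And>x t. 0 < t \<Longrightarrow> t < T \<Longrightarrow> D (x, t) (a (x, t), 1) \<le> E + L * \<bar>w (x, t)\<bar>"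
      and init: "\<And>x. w (x, 0) \<le> B"
    for w D
  proof -
    have "w (x, t) * exp (- L * t) \<le> B + t * E"
    proof (rule field_le_epsilon)
      fix \<epsilon> :: real assume \<epsilon>: "0 < \<epsilon>"
      define \<delta> where "\<delta> = \<epsilon> / (t + 1)"
      have \<delta>: "0 < \<delta>" "t * \<delta> \<le> \<epsilon>"
        using t \<epsilon> by (auto simp: \<delta>_def field_simps)
      \<comment> \<open>If d is the derivative of w along (a, 1), that of \<phi> is (d - L w) exp(-L
        t) - (E + \<delta>).\<close>
      define \<phi> where "\<phi> p = w p * exp (- L * snd p) - snd p * (E + \<delta>)" for p
      define D\<phi> where "D\<phi> p q = D p q * exp (- L * snd p) - L * snd q * w p * exp (- L * snd p)
        - snd q * (E + \<delta>)" for p q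
      have "\<phi> (x, t) \<le> B"
      proof (rule transport_maximum_principle[where D = D\<phi> and a = a and V = V])
        show "continuous_on (UNIV \<times> {0..<T}) \<phi>"
          unfolding \<phi>_def by (intro continuous_intros w)
        show "(\<phi> has_derivative D\<phi> (x, t)) (at (x, t))" if "0 < t" "t < T" for x t
          unfolding \<phi>_def D\<phi>_def
          by (auto intro!: derivative_eq_intros der that simp: fun_eq_iff algebra_simps)
        show "D\<phi> (x, t) (a (x, t), 1) < 0" if "0 < t" "t < T" "B < \<phi> (x, t)" for x t
        proof -
          \<comment> \<open>As B >= 0, \<phi> > B forces w > 0. Hence |w| = w and the two terms with
            L cancel.\<close>
          have "0 \<le> t * (E + \<delta>)"
            using that E \<delta> by simp
          then have "0 < w (x, t) * exp (- L * t)"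
            using that(3) B unfolding \<phi>_def by simp
          then have "0 < w (x, t)"
            by (simp add: zero_less_mult_iff)
          then have "D (x, t) (a (x, t), 1) - L * w (x, t) \<le> E"
            using eq[of t x] that by simp
          \<comment> \<open>The weight is at most 1, so the derivative of \<phi> is at most E - (E +
            \<delta>) = -\<delta>.\<close>
          then have "(D (x, t) (a (x, t), 1) - L * w (x, t)) * exp (- L * t) \<le> E * exp (- L * t)"
            by (rule mult_right_mono) simp
          also have "\<dots> \<le> E * 1"
            using E L that by (intro mult_left_mono) auto
          finally show ?thesis
            using \<delta> by (simp add: D\<phi>_def algebra_simps)
        qed
      qed (use a V init t in \<open>auto simp: \<phi>_def\<close>)
      then show "w (x, t) * exp (- L * t) \<le> B + t * E + \<epsilon>"
        using \<delta> by (simp add: \<phi>_def algebra_simps)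
    qed
    then have "w (x, t) * exp (- L * t) * exp (L * t) \<le> (B + t * E) * exp (L * t)"
      by (rule mult_right_mono) simp
    then show ?thesis
      by (simp add: mult.assoc flip: exp_add)
  qed
  have "v (x, t) - u (x, t) \<le> (B + t * E) * exp (L * t)"
  proof (rule one_sided[where D = "\<lambda>p q. Dv p q - Du p q"])
    show "Dv (x, t) (a (x, t), 1) - Du (x, t) (a (x, t), 1) \<le> E + L * \<bar>v (x, t) - u (x, t)\<bar>"
      if "0 < t" "t < T" for x t
      using eq[OF that, of x] by linarith
    show "v (x, 0) - u (x, 0) \<le> B" for x
      using init[of x] by linarith
  qed (auto intro!: continuous_intros derivative_intros u v der_u der_v)
  moreover have "u (x, t) - v (x, t) \<le> (B + t * E) * exp (L * t)"
  proof (rule one_sided[where D = "\<lambda>p q. Du p q - Dv p q"])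
    show "Du (x, t) (a (x, t), 1) - Dv (x, t) (a (x, t), 1) \<le> E + L * \<bar>u (x, t) - v (x, t)\<bar>"
      if "0 < t" "t < T" for x t
      unfolding abs_minus_commute[of "u (x, t)" "v (x, t)"] using eq[OF that, of x] by linarith
    show "u (x, 0) - v (x, 0) \<le> B" for x
      using init[of x] by linarith
  qed (auto intro!: continuous_intros derivative_intros u v der_u der_v)
  ultimately show ?thesis
    by linarith
qed

section \<open>Continuously differentiable functions\<close>

lemma Ck_on_1: "Ck_on 1 S g \<longleftrightarrow> g differentiable_on S \<and> (\<forall>d\<in>Basis. continuous_on S (partial S d g))"
  by simp

text \<open>Derivatives on the whole space are unique, so the partials can be read off from any
  explicit derivative D.\<close>

lemma Ck_on_1I:
  assumes "\<And>p. (g has_derivative D p) (at p)"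
    and "\<And>d. d \<in> Basis \<Longrightarrow> continuous_on UNIV (\<lambda>p. D p d)"
  shows "Ck_on 1 UNIV g"
proof -
  have "partial UNIV d g = (\<lambda>p. D p d)" for d
    by (rule ext) (simp add: partial_def flip: frechet_derivative_at[OF assms(1)])
  then show ?thesis
    using assms by (auto simp: Ck_on_1 differentiable_on_def intro: differentiableI)
qed

lemma Ck_on_1D:
  assumes "Ck_on 1 UNIV g"
  shows "(g has_derivative (\<lambda>d. partial UNIV d g p)) (at p)"
    and "d \<in> Basis \<Longrightarrow> continuous_on UNIV (partial UNIV d g)"
  using assms by (auto simp: Ck_on_1 differentiable_on_def partial_def frechet_derivative_works)

lemma Ck_on_1_bounded_linear: "bounded_linear g \<Longrightarrow> Ck_on 1 UNIV g"
  by (rule Ck_on_1I[where D = "\<lambda>p. g"]) (auto intro: bounded_linear_imp_has_derivative)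

lemma Ck_on_1_const: "Ck_on 1 UNIV (\<lambda>p. c)"
  by (rule Ck_on_1I[where D = "\<lambda>p q. 0"]) auto

lemma Ck_on_1_add: "Ck_on 1 UNIV g \<Longrightarrow> Ck_on 1 UNIV h \<Longrightarrow> Ck_on 1 UNIV (\<lambda>p. g p + h p)"
  by (rule Ck_on_1I[where D = "\<lambda>p d. partial UNIV d g p + partial UNIV d h p"])
    (auto intro!: derivative_intros continuous_intros Ck_on_1D)

lemma Ck_on_1_cmult:
  fixes g :: "'a::euclidean_space \<Rightarrow> real"
  shows "Ck_on 1 UNIV g \<Longrightarrow> Ck_on 1 UNIV (\<lambda>p. c * g p)"
  by (rule Ck_on_1I[where D = "\<lambda>p d. c * partial UNIV d g p"])
    (auto intro!: derivative_intros continuous_intros Ck_on_1D)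

lemma Ck_on_1_sum:
  "(\<And>j. j \<in> J \<Longrightarrow> Ck_on 1 UNIV (g j)) \<Longrightarrow> Ck_on 1 UNIV (\<lambda>p. \<Sum>j\<in>J. g j p)"
  by (induction J rule: infinite_finite_induct)
    (simp_all del: Ck_on.simps One_nat_def add: Ck_on_1_const Ck_on_1_add)

lemma Ck_on_1_compose:
  fixes g :: "'a::euclidean_space \<Rightarrow> real" and \<sigma> :: "real \<Rightarrow> real"
  assumes \<sigma>: "Ck_on 1 UNIV \<sigma>" and g: "Ck_on 1 UNIV g"
  shows "Ck_on 1 UNIV (\<lambda>p. \<sigma> (g p))"
proof -
  define \<sigma>' where "\<sigma>' = partial UNIV 1 \<sigma>"
  \<comment> \<open>A linear map on the reals is determined by its value at 1. This gives the chain
    rule a product form whose continuity can be checked factor by factor.\<close>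
  have scale: "partial UNIV s \<sigma> r = \<sigma>' r * s" for s r
    using linear_scale[OF has_derivative_linear[OF Ck_on_1D(1)[OF \<sigma>, of r]], of s 1]
    by (simp add: \<sigma>'_def)
  show ?thesis
  proof (rule Ck_on_1I[where D = "\<lambda>p d. \<sigma>' (g p) * partial UNIV d g p"])
    show "((\<lambda>p. \<sigma> (g p)) has_derivative (\<lambda>d. \<sigma>' (g p) * partial UNIV d g p)) (at p)" for p
      using has_derivative_compose[OF Ck_on_1D(1)[OF g] Ck_on_1D(1)[OF \<sigma>], of p]
      by (simp only: scale)
    have "continuous_on UNIV g"
      using g by (simp add: differentiable_imp_continuous_on)
    then have "continuous_on UNIV (\<lambda>p. \<sigma>' (g p))"
      unfolding \<sigma>'_def by (intro continuous_on_compose2[OF Ck_on_1D(2)[OF \<sigma>]]) auto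
    then show "continuous_on UNIV (\<lambda>p. \<sigma>' (g p) * partial UNIV d g p)" if "d \<in> Basis" for d
      using that by (intro continuous_intros Ck_on_1D(2)[OF g])
  qed
qed

text \<open>Expands (a, s) in the standard basis. With a = f (v p) and s = 1 the right-hand side is
  the transport operator of the conservation law.\<close>

lemma frechet_derivative_space_time:
  fixes v :: "(real ^ 'n) \<times> real \<Rightarrow> real"
  assumes "v differentiable (at p within S)"
  shows "frechet_derivative v (at p within S) (a, s) = a \<bullet> grad_x S v p + s * d_t S v p"
proof -
  let ?D = "frechet_derivative v (at p within S)"
  interpret D: linear ?D
    using assms by (rule linear_frechet_derivative)
  have "(a, s) = (\<Sum>i\<in>UNIV. a $ i *\<^sub>R (axis i 1, 0)) + s *\<^sub>R (0, 1)"
    using basis_expansion[of a] by (simp add: prod_eq_iff fst_sum snd_sum scalar_mult_eq_scaleR)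
  then have "?D (a, s) = (\<Sum>i\<in>UNIV. a $ i * ?D (axis i 1, 0)) + s * ?D (0, 1)"
    by (simp only: D.add D.sum D.scale real_scaleR_def)
  then show ?thesis
    by (simp add: grad_x_def d_t_def partial_def inner_vec_def)
qed

lemma continuous_on_grad_x:
  "Ck_on 1 S v \<Longrightarrow> continuous_on S (grad_x S v)"
  unfolding Ck_on_1 grad_x_def
  by (intro continuous_on_vec_lambda) (auto simp: Basis_prod_def Basis_vec_def)

lemma continuous_on_d_t: "Ck_on 1 S v \<Longrightarrow> continuous_on S (d_t S v)"
  unfolding Ck_on_1 d_t_def[abs_def]
  by (auto simp: Basis_prod_def zero_prod_def)

lemma continuous_on_grad: "Ck_on 1 UNIV g \<Longrightarrow> continuous_on UNIV (grad g)"
  unfolding Ck_on_1 grad_def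
  by (intro continuous_on_vec_lambda) (auto simp: Basis_vec_def)

text \<open>On the reals \<open>partial UNIV 1\<close> is the vector derivative; this links
  \<open>Ck_on\<close> for the flux to the definitions of \<open>f\<close> and \<open>f'\<close> by
  \<open>vector_derivative\<close>.\<close>

lemma Ck_on_Suc_real:
  fixes F :: "real \<Rightarrow> 'b::real_normed_vector"
  assumes "Ck_on (Suc r) UNIV F"
  shows "(F has_vector_derivative vector_derivative F (at s)) (at s)"
    and "Ck_on r UNIV (\<lambda>s. vector_derivative F (at s))"
proof -
  have diff: "F differentiable (at s)" for s
    using assms by (simp add: differentiable_on_def)
  then show D: "(F has_vector_derivative vector_derivative F (at s)) (at s)" for s
    by (simp add: vector_derivative_works)
  have "partial UNIV 1 F = (\<lambda>s. vector_derivative F (at s))"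
    by (rule ext) (simp add: partial_def flip: frechet_derivative_at[OF D[unfolded has_vector_derivative_def]])
  then show "Ck_on r UNIV (\<lambda>s. vector_derivative F (at s))"
    using assms by simp
qed

section \<open>Networks\<close>

lemma Ck_on_1_affine_layer:
  fixes w :: "real mat"
  assumes w: "w \<in> carrier_mat r n" and b: "b \<in> carrier_vec r"
    and y: "\<And>p. y p \<in> carrier_vec n" "\<And>j. j < n \<Longrightarrow> Ck_on 1 UNIV (\<lambda>p. vec_index (y p) j)"
    and i: "i < r"
  shows "Ck_on 1 UNIV (\<lambda>p. vec_index (w *\<^sub>v y p + b) i)"
proof -
  have "vec_index (w *\<^sub>v y p + b) i = (\<Sum>j<n. w $$ (i, j) * vec_index (y p) j) + vec_index b i" for p
    using w b y(1)[of p] i by (auto simp: scalar_prod_def atLeast0LessThan)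
  then show ?thesis
    by (simp only:) (intro Ck_on_1_add Ck_on_1_sum Ck_on_1_cmult Ck_on_1_const y(2), simp)
qed

text \<open>Induction on the layers, peeling off the one next to the input. The input map
  \<open>y\<close> is arbitrary, so the activated output of that layer can take its place.
  Regularity is stated by coordinates because the dimension changes from layer to layer.\<close>

lemma Ck_on_1_net_eval:
  assumes \<sigma>: "Ck_on 1 UNIV \<sigma>"
    and "length \<theta> > 0" "\<theta> \<in> net_params A"
    and "\<And>p. y p \<in> carrier_vec (hd A)" "\<And>j. j < hd A \<Longrightarrow> Ck_on 1 UNIV (\<lambda>p. vec_index (y p) j)"
    and "i < last A"
  shows "Ck_on 1 UNIV (\<lambda>p. vec_index (net_eval \<sigma> \<theta> (y p)) i)"
  using assms(2-)
proof (induction \<theta> arbitrary: A y)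
  case Nil
  then show ?case
    by simp
next
  case (Cons wb \<theta>)
  obtain w b where wb: "wb = (w, b)"
    by (cases wb)
  obtain n r A' where A: "A = n # r # A'"
    using Cons.prems(2) by (auto simp: net_params_def length_Suc_conv)
  have w: "w \<in> carrier_mat r n" and b: "b \<in> carrier_vec r"
    using Cons.prems(2) by (auto simp: net_params_def A wb dest: spec[of _ 0])
  have \<theta>: "\<theta> \<in> net_params (r # A')"
    using Cons.prems(2) by (auto simp: net_params_def A)
  have y: "\<And>p. y p \<in> carrier_vec n" "\<And>j. j < n \<Longrightarrow> Ck_on 1 UNIV (\<lambda>p. vec_index (y p) j)"
    using Cons.prems by (auto simp: A simp del: Ck_on.simps)
  have layer: "Ck_on 1 UNIV (\<lambda>p. vec_index (w *\<^sub>v y p + b) j)" if "j < r" for j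
    using Ck_on_1_affine_layer[OF w b y that] .
  have dim: "w *\<^sub>v y p + b \<in> carrier_vec r" for p
    using w b y(1) by (intro add_carrier_vec mult_mat_vec_carrier)
  show ?case
  \<comment> \<open>The last layer has no activation, so a single remaining layer is a case of its
    own.\<close>
  proof (cases \<theta>)
    case Nil
    then have "A' = []"
      using \<theta> by (simp add: net_params_def)
    then show ?thesis
      using layer[of i] Cons.prems(5) by (simp add: wb Nil A del: Ck_on.simps One_nat_def)
  next
    case (Cons wb' \<theta>')
    have eq: "net_eval \<sigma> (wb # \<theta>) z = net_eval \<sigma> \<theta> (map_vec \<sigma> (w *\<^sub>v z + b))" for z
      by (simp add: wb Cons)
    have "Ck_on 1 UNIV (\<lambda>p. vec_index (map_vec \<sigma> (w *\<^sub>v y p + b)) j)" if "j < r" for j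
    proof -
      have "vec_index (map_vec \<sigma> (w *\<^sub>v y p + b)) j = \<sigma> (vec_index (w *\<^sub>v y p + b) j)" for p
        using dim[of p] that by (intro index_map_vec) (metis carrier_vecD)
      then show ?thesis
        using Ck_on_1_compose[OF \<sigma> layer[OF that]] by simp
    qed
    then show ?thesis
      unfolding eq using \<theta> Cons Cons.prems(5) dim
      by (intro Cons.IH[of "r # A'"]) (auto simp: A simp del: Ck_on.simps)
  qed
qed

text \<open>Each coordinate of \<open>net_input\<close> is a bounded linear function of (x, t), and
  length A >= 2 provides at least one layer.\<close>

lemma Ck_on_1_network:
  fixes v :: "(real ^ 'n) \<times> real \<Rightarrow> real"
  assumes "smooth \<sigma>" "length A \<ge> 2" "hd A = CARD('n) + 1" "last A = 1" "v \<in> networks \<sigma> A"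
  shows "Ck_on 1 UNIV v"
proof -
  obtain \<theta> where \<theta>: "\<theta> \<in> net_params A"
    and v: "v = (\<lambda>p. vec_index (net_eval \<sigma> \<theta> (net_input p)) 0)"
    using assms(5) by (auto simp: networks_def)
  have "Ck_on 1 UNIV (\<lambda>p :: (real ^ 'n) \<times> real. vec_index (net_input p) j)" if "j < CARD('n) + 1" for j
  proof (cases "j < CARD('n)")
    case True
    have "bounded_linear (\<lambda>p :: (real ^ 'n) \<times> real. fst p $ coord j)"
      by (intro bounded_linear_compose[OF bounded_linear_vec_nth] bounded_linear_fst)
    with True show ?thesis
      by (simp add: net_input_def Ck_on_1_bounded_linear del: Ck_on.simps One_nat_def)
  next
    case False
    with that show ?thesis
      by (simp add: net_input_def Ck_on_1_bounded_linear bounded_linear_snd del: Ck_on.simps One_nat_def)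
  qed
  then show ?thesis
    unfolding v using assms \<theta>
    by (intro Ck_on_1_net_eval[where A = A])
      (auto simp: smooth_def net_params_def net_input_def simp del: Ck_on.simps)
qed

section \<open>Essential and pointwise bounds\<close>

lemma Linf_norm_nonneg: "0 \<le> Linf_norm S g"
  by (simp add: Linf_norm_def)

text \<open>A continuous function exceeding its essential supremum at a point of W does so on a
  nonempty open set, which has positive measure. S may be larger than W, as is the closed strip
  around its interior.\<close>

lemma norm_le_Linf_norm:
  fixes g :: "'a::euclidean_space \<Rightarrow> 'b::real_normed_vector"
  assumes S: "S \<in> sets borel" and W: "open W" "W \<subseteq> S" and g: "continuous_on W g" and x: "x \<in> W"
  shows "ereal (norm (g x)) \<le> Linf_norm S g"
proof (rule ccontr)
  assume "\<not> ereal (norm (g x)) \<le> Linf_norm S g"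
  then obtain r where r: "Linf_norm S g = ereal r" "r < norm (g x)"
    using Linf_norm_nonneg[of S g] by (cases "Linf_norm S g") auto
  have r0: "0 \<le> r"
    using Linf_norm_nonneg[of S g] r by simp
  let ?s = "esssup (restrict_space lborel S) (\<lambda>x. ennreal (norm (g x)))"
  have s: "?s = ennreal r"
    using r by (metis Linf_norm_def e2ennreal_enn2ereal e2ennreal_ereal)
  define N where "N = {y \<in> W. r < norm (g y)}"
  have "open (W \<inter> (\<lambda>y. norm (g y)) -` {r<..})"
    using g W by (intro continuous_open_preimage continuous_intros) auto
  then have "open N"
    by (simp add: N_def vimage_def Int_def)
  have "AE y in restrict_space lborel S. ennreal (norm (g y)) \<le> ?s"
    by (rule esssup_AE)
  then have "AE y in lborel. y \<in> S \<longrightarrow> norm (g y) \<le> r"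
    using S r0 by (simp add: AE_restrict_space_iff s)
  \<comment> \<open>\<open>N\<close> lies in S, so it is null; but it is open and contains
    x.\<close>
  then have "AE y in lborel. y \<notin> N"
    using W by (auto simp: N_def elim!: eventually_mono)
  then have "emeasure lborel N = 0"
    using AE_iff_measurable[of N lborel "\<lambda>y. y \<notin> N"] \<open>open N\<close> by simp
  moreover have "x \<in> N"
    using x r by (simp add: N_def)
  ultimately show False
    using open_not_negligible[of N] null_sets_completionI[of N lborel] \<open>open N\<close>
    by (auto simp: negligible_iff_null_sets null_sets_def)
qed

lemma Linf_norm_leI:
  assumes "continuous_on S g" "S \<in> sets borel" "0 \<le> c" "\<And>x. x \<in> S \<Longrightarrow> norm (g x) \<le> c"
  shows "Linf_norm S g \<le> ereal c"
proof -
  have "esssup (restrict_space lborel S) (\<lambda>x. ennreal (norm (g x))) \<le> ennreal c"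
  proof (rule esssup_I)
    \<comment> \<open>Continuity supplies the measurability that \<open>esssup_I\<close> asks
      for.\<close>
    have "(\<lambda>x. norm (g x)) \<in> borel_measurable (restrict_space borel S)"
      by (intro borel_measurable_continuous_on_restrict continuous_intros assms)
    moreover have "sets (restrict_space lborel S) = sets (restrict_space borel S)"
      by (intro sets_restrict_space_cong) simp
    ultimately have "(\<lambda>x. norm (g x)) \<in> borel_measurable (restrict_space lborel S)"
      using measurable_cong_sets by blast
    then show "(\<lambda>x. ennreal (norm (g x))) \<in> borel_measurable (restrict_space lborel S)"
      by measurable
    show "AE x in restrict_space lborel S. ennreal (norm (g x)) \<le> ennreal c"
      using assms by (simp add: AE_restrict_space_iff)
  qed
  then have "Linf_norm S g \<le> enn2ereal (ennreal c)"
    by (simp add: Linf_norm_def less_eq_ennreal.rep_eq)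
  then show ?thesis
    using assms by simp
qed

lemma Linf_norm_finite:
  assumes "continuous_on S g" "S \<in> sets borel" "bounded (g ` S)"
  obtains c where "0 \<le> c" "Linf_norm S g = ereal c"
proof -
  obtain b where "0 \<le> b" "\<And>x. x \<in> S \<Longrightarrow> norm (g x) \<le> b"
    using assms(3) unfolding bounded_pos by (metis imageI less_imp_le)
  then have "Linf_norm S g \<le> ereal b"
    by (intro Linf_norm_leI assms) auto
  then show thesis
    using Linf_norm_nonneg[of S g] that by (cases "Linf_norm S g") auto
qed

lemma bounded_range_compact_support:
  assumes "continuous_on UNIV g" "compact K" "\<And>x. x \<notin> K \<Longrightarrow> g x = 0"
  shows "bounded (range g)"
proof (rule bounded_subset)
  show "bounded (insert 0 (g ` K))"
    using assms(2) unfolding bounded_insert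
    by (intro compact_imp_bounded compact_continuous_image continuous_on_subset[OF assms(1)]) auto
  show "range g \<subseteq> insert 0 (g ` K)"
    using assms(3) by auto
qed

text \<open>The complement of the support is open, so g agrees with 0 near x. Thus the gradient of
  compactly supported data is again compactly supported.\<close>

lemma grad_eq_0_outside_support:
  assumes "x \<notin> closure {x. g x \<noteq> 0}"
  shows "grad g x = 0"
proof -
  have "(g has_derivative (\<lambda>d. 0)) (at x)"
  proof (rule has_derivative_transform_within_open[where s = "- closure {x. g x \<noteq> 0}"])
    show "0 = g y" if "y \<in> - closure {x. g x \<noteq> 0}" for y
      using that closure_subset[of "{x. g x \<noteq> 0}"] by auto
  qed (use assms in auto)
  from frechet_derivative_at[OF this, symmetric] show ?thesis
    by (simp add: grad_def partial_def Finite_Cartesian_Product.vec_eq_iff)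
qed

lemma ball0_ereal: "ball0 (ereal c) = {-c<..<c}"
  by (auto simp: ball0_def)

text \<open>The ball lies in a compact interval; for r <= 0 it is empty.\<close>

lemma Linf_norm_ball0_finite:
  assumes "continuous_on UNIV g"
  obtains c where "0 \<le> c" "Linf_norm (ball0 (ereal r)) g = ereal c"
proof (rule Linf_norm_finite)
  have "bounded (g ` {-r..r})"
    by (intro compact_imp_bounded compact_continuous_image continuous_on_subset[OF assms]) auto
  then show "bounded (g ` ball0 (ereal r))"
    by (rule bounded_subset) (auto simp: ball0_ereal)
  show "continuous_on (ball0 (ereal r)) g"
    using assms by (rule continuous_on_subset) auto
  show "ball0 (ereal r) \<in> sets borel"
    by (simp add: ball0_ereal)
qed

text \<open>The mean value inequality evaluates the derivative strictly between a and b, so a bound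
  on the open interval suffices even for endpoints with absolute value r.\<close>

lemma lipschitz_of_vector_derivative_bound:
  fixes f :: "real \<Rightarrow> 'b::real_inner"
  assumes der: "\<And>s. (f has_vector_derivative f' s) (at s)"
    and bound: "\<And>s. \<bar>s\<bar> < r \<Longrightarrow> norm (f' s) \<le> L"
    and ab: "\<bar>a\<bar> \<le> r" "\<bar>b\<bar> \<le> r"
  shows "norm (f a - f b) \<le> L * \<bar>a - b\<bar>"
proof -
  have *: "norm (f b - f a) \<le> L * (b - a)" if "a < b" "\<bar>a\<bar> \<le> r" "\<bar>b\<bar> \<le> r" for a b
  proof -
    have "continuous_on {a..b} f"
      by (intro continuous_at_imp_continuous_on ballI has_vector_derivative_continuous[OF der])
    then obtain s where s: "a < s" "s < b" "norm (f b - f a) \<le> norm ((b - a) *\<^sub>R f' s)"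
      using mvt_general[OF \<open>a < b\<close>, of f "\<lambda>s d. d *\<^sub>R f' s"] der
      by (auto simp: has_vector_derivative_def)
    note s(3)
    also have "norm ((b - a) *\<^sub>R f' s) = norm (f' s) * (b - a)"
      using \<open>a < b\<close> by simp
    also have "\<dots> \<le> L * (b - a)"
      using s that by (intro mult_right_mono bound) auto
    finally show ?thesis .
  qed
  consider "a < b" | "a = b" | "b < a"
    by linarith
  then show ?thesis
    using *[of a b] *[of b a] ab by cases (auto simp: norm_minus_commute)
qed

lemma exp_ereal_pos: "0 \<le> x \<Longrightarrow> 0 < exp_ereal x"
  by (cases x) (auto simp: exp_ereal_def)

section \<open>The error estimate\<close>

theorem theorem2p3:
  fixes F f f' :: "real \<Rightarrow> real ^ 'n"
    and u0 :: "real ^ 'n \<Rightarrow> real"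
    and u U e \<epsilon>\<^sub>i :: "(real ^ 'n) \<times> real \<Rightarrow> real"
    and \<epsilon>\<^sub>b :: "real ^ 'n \<Rightarrow> real"
    and \<sigma> :: "real \<Rightarrow> real"
    and A :: "nat list"
    and k m :: nat
    and T C :: real
    and \<rho>\<^sub>0 \<rho>\<^sub>0\<^sub>U \<rho>\<^sub>1 :: ereal
  assumes "Ck_on 2 UNIV F"
    and "f = (\<lambda>s. vector_derivative F (at s))"
    and "f' = (\<lambda>s. vector_derivative f (at s))"
    and "Ck_on 1 UNIV u0"
    and "compact (closure {x. u0 x \<noteq> 0})"
    and "T > 0"
    and "classical_solution f T u0 u"
    and "smooth \<sigma>" and "\<not> linear \<sigma>"
    and "length A \<ge> 2" and "hd A = CARD('n) + 1" and "last A = 1"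
    and "is_arg_min (loss f T u0 k m) (\<lambda>v. v \<in> networks \<sigma> A) U"
    and "\<epsilon>\<^sub>i = (\<lambda>p. d_t UNIV U p + f (U p) \<bullet> grad_x UNIV U p)"
    and "\<epsilon>\<^sub>b = (\<lambda>x. U (x, 0) - u0 x)"
    and "e = (\<lambda>p. U p - u p)"
    and "\<rho>\<^sub>0 = Linf_norm UNIV u0"
    and "\<rho>\<^sub>0\<^sub>U = Linf_norm UNIV u0 + Linf_norm UNIV \<epsilon>\<^sub>b + ereal T * Linf_norm (strip T) \<epsilon>\<^sub>i"
    and "\<rho>\<^sub>1 = Linf_norm UNIV (grad u0) + ereal C * Linf_norm (ball0 \<rho>\<^sub>0) f'"
    and "Linf_norm (strip T) (grad_x (strip T) u) \<le> \<rho>\<^sub>1"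
  shows "Linf_norm (strip T) e
    \<le> (Linf_norm UNIV \<epsilon>\<^sub>b + ereal T * Linf_norm (strip T) \<epsilon>\<^sub>i)
        * exp_ereal (ereal T * Linf_norm (ball0 (\<rho>\<^sub>0 + \<rho>\<^sub>0\<^sub>U)) f' * \<rho>\<^sub>1)"
proof -

  \<comment> \<open>Regularity of the flux, the network and the solution\<close>
  have F: "Ck_on (Suc (Suc 0)) UNIV F"
    using assms(1) by (simp only: numeral_2_eq_2)
  have f1: "Ck_on (Suc 0) UNIV f"
    unfolding assms(2) by (rule Ck_on_Suc_real(2)[OF F])
  have f': "\<And>s. (f has_vector_derivative f' s) (at s)" "continuous_on UNIV f'"
    using Ck_on_Suc_real[OF f1] by (auto simp: assms(3))
  have f: "continuous_on UNIV f"
    using f1 by (simp add: differentiable_imp_continuous_on)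
  have U: "Ck_on 1 UNIV U"
    using assms(8,10,11,12,13) by (intro Ck_on_1_network) (auto simp: is_arg_min_def)
  have contU: "continuous_on S U" for S
    using U by (intro continuous_on_subset[OF differentiable_imp_continuous_on]) auto
  have u: "Ck_on 1 (strip T) u" and u_0: "\<And>x. u (x, 0) = u0 x"
    and pde: "\<And>x t. 0 < t \<Longrightarrow> t < T \<Longrightarrow>
      d_t (strip T) u (x, t) + f (u (x, t)) \<bullet> grad_x (strip T) u (x, t) = 0"
    using assms(7) by (auto simp: classical_solution_def simp del: Ck_on.simps)
  have contu: "continuous_on (strip T) u"
    using u by (simp add: differentiable_imp_continuous_on)
  have contu0: "continuous_on UNIV u0"
    using assms(4) by (simp add: differentiable_imp_continuous_on)

  \<comment> \<open>The open part of the strip, where derivatives within the strip are ordinary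
    derivatives and essential bounds of continuous functions hold pointwise.\<close>
  define W :: "((real ^ 'n) \<times> real) set" where "W = UNIV \<times> {0<..<T}"
  have W: "open W" "W \<subseteq> strip T" "\<And>x t. (x, t) \<in> W \<longleftrightarrow> 0 < t \<and> t < T"
    by (auto simp: W_def strip_def intro: open_Times)
  have strip: "strip T \<in> sets (borel :: ((real ^ 'n) \<times> real) measure)"
    unfolding strip_def by (intro borel_closed closed_Times) auto

  \<comment> \<open>Finiteness of the constants determined by the data\<close>
  have "bounded (range u0)"
    using closure_subset[of "{x. u0 x \<noteq> 0}"]
    by (intro bounded_range_compact_support[OF contu0 assms(5)]) auto
  then obtain r0 where r0: "0 \<le> r0" "Linf_norm UNIV u0 = ereal r0"
    using Linf_norm_finite[OF contu0] by auto
  have grad_u0: "continuous_on UNIV (grad u0)"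
    using assms(4) by (rule continuous_on_grad)
  then have "bounded (range (grad u0))"
    by (rule bounded_range_compact_support[OF _ assms(5) grad_eq_0_outside_support])
  then obtain g0 where g0: "Linf_norm UNIV (grad u0) = ereal g0"
    using Linf_norm_finite[OF grad_u0] by auto
  obtain c0 where "Linf_norm (ball0 (ereal r0)) f' = ereal c0"
    using Linf_norm_ball0_finite[OF f'(2)] by metis
  with g0 obtain r1 where r1: "\<rho>\<^sub>1 = ereal r1"
    by (simp add: assms(17,19) r0)
  \<comment> \<open>\<open>C\<close> may have either sign; nonnegativity comes from the gradient
    bound, whose left side is a norm.\<close>
  have \<rho>1: "0 \<le> \<rho>\<^sub>1"
    using Linf_norm_nonneg assms(20) by (rule order_trans)

  show ?thesis
  \<comment> \<open>An infinite residual norm makes the first factor \<infinity> because T > 0; the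
    exponential factor is positive, so the product is \<infinity> too.\<close>
  proof (cases "Linf_norm UNIV \<epsilon>\<^sub>b = \<infinity> \<or> Linf_norm (strip T) \<epsilon>\<^sub>i = \<infinity>")
    case True
    then have "Linf_norm UNIV \<epsilon>\<^sub>b + ereal T * Linf_norm (strip T) \<epsilon>\<^sub>i = \<infinity>"
      using assms(6) by auto
    moreover have "0 < exp_ereal (ereal T * Linf_norm (ball0 (\<rho>\<^sub>0 + \<rho>\<^sub>0\<^sub>U)) f' * \<rho>\<^sub>1)"
      using assms(6) \<rho>1 by (intro exp_ereal_pos ereal_0_le_mult Linf_norm_nonneg) auto
    ultimately show ?thesis
      by (auto simp only: ereal_infty_mult less_irrefl if_True if_False split: if_splits intro: ereal_less_eq(1))
  next
    case False
    obtain b where b: "0 \<le> b" "Linf_norm UNIV \<epsilon>\<^sub>b = ereal b"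
      using False Linf_norm_nonneg[of UNIV \<epsilon>\<^sub>b] by (cases "Linf_norm UNIV \<epsilon>\<^sub>b") auto
    obtain \<epsilon> where \<epsilon>: "0 \<le> \<epsilon>" "Linf_norm (strip T) \<epsilon>\<^sub>i = ereal \<epsilon>"
      using False Linf_norm_nonneg[of "strip T" \<epsilon>\<^sub>i] by (cases "Linf_norm (strip T) \<epsilon>\<^sub>i") auto
    \<comment> \<open>This is the real value of \<open>\<rho>\<^sub>0\<^sub>U\<close>. It will bound
      U, and also u because r0 <= R.\<close>
    define R where "R = r0 + b + T * \<epsilon>"
    have R: "r0 \<le> R"
      using b \<epsilon> assms(6) by (simp add: R_def)
    have \<rho>U: "\<rho>\<^sub>0 + \<rho>\<^sub>0\<^sub>U = ereal (r0 + R)"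
      by (simp add: assms(17,18) r0 b \<epsilon> R_def)
    obtain l where l: "0 \<le> l" "Linf_norm (ball0 (\<rho>\<^sub>0 + \<rho>\<^sub>0\<^sub>U)) f' = ereal l"
      unfolding \<rho>U using Linf_norm_ball0_finite[OF f'(2)] by metis

    \<comment> \<open>Pointwise bounds from the essential ones\<close>
    have u0_le: "\<bar>u0 x\<bar> \<le> r0" for x
      using norm_le_Linf_norm[of UNIV UNIV u0 x] contu0 r0 by simp
    have "continuous_on UNIV \<epsilon>\<^sub>b"
      unfolding assms(15)
      by (intro continuous_intros contu0 continuous_on_compose2[OF contU[of UNIV]]) auto
    then have b_le: "\<bar>\<epsilon>\<^sub>b x\<bar> \<le> b" for x
      using norm_le_Linf_norm[of UNIV UNIV \<epsilon>\<^sub>b x] b by simp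
    have "continuous_on UNIV \<epsilon>\<^sub>i"
      unfolding assms(14)
      by (intro continuous_intros continuous_on_d_t continuous_on_grad_x U
          continuous_on_compose2[OF f contU[of UNIV]]) auto
    then have \<epsilon>_le: "\<bar>\<epsilon>\<^sub>i (x, t)\<bar> \<le> \<epsilon>" if "0 < t" "t < T" for x t
      using norm_le_Linf_norm[OF strip W(1,2), of \<epsilon>\<^sub>i "(x, t)"] that \<epsilon> W(3)
      by (auto intro: continuous_on_subset)
    have grad_le: "norm (grad_x (strip T) u (x, t)) \<le> r1" if "0 < t" "t < T" for x t
    proof -
      have "continuous_on W (grad_x (strip T) u)"
        using continuous_on_grad_x[OF u] W(2) by (rule continuous_on_subset)
      then have "ereal (norm (grad_x (strip T) u (x, t))) \<le> \<rho>\<^sub>1"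
        using that W by (intro order_trans[OF norm_le_Linf_norm[OF strip W(1,2)] assms(20)]) auto
      then show ?thesis
        by (simp add: r1)
    qed
    have f'_le: "norm (f' s) \<le> l" if "\<bar>s\<bar> < r0 + R" for s
    proof -
      have "ereal (norm (f' s)) \<le> Linf_norm (ball0 (\<rho>\<^sub>0 + \<rho>\<^sub>0\<^sub>U)) f'"
        using that f'(2) unfolding \<rho>U ball0_ereal
        by (intro norm_le_Linf_norm[where W = "{-(r0 + R)<..<r0 + R}"])
          (auto intro: continuous_on_subset)
      then show ?thesis
        by (simp add: l)
    qed

    \<comment> \<open>Derivatives along the direction (a, 1)\<close>
    define Du where "Du p = frechet_derivative u (at p within strip T)" for p
    define DU where "DU p = frechet_derivative U (at p)" for p
    have der_u: "(u has_derivative Du (x, t)) (at (x, t))"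
      and Du: "Du (x, t) (a, 1) = a \<bullet> grad_x (strip T) u (x, t) + d_t (strip T) u (x, t)"
      if "0 < t" "t < T" for x t a
    proof -
      have diff: "u differentiable (at (x, t) within strip T)"
        using u that by (auto simp: differentiable_on_def strip_def)
      moreover have "at (x, t) within strip T = at (x, t)"
        using that W by (intro at_within_open_subset[of _ W]) auto
      ultimately show "(u has_derivative Du (x, t)) (at (x, t))"
        by (simp add: Du_def frechet_derivative_works)
      show "Du (x, t) (a, 1) = a \<bullet> grad_x (strip T) u (x, t) + d_t (strip T) u (x, t)"
        using frechet_derivative_space_time[OF diff] by (simp add: Du_def)
    qed
    have diffU: "U differentiable (at p)" for p
      using Ck_on_1D(1)[OF U] by (rule differentiableI)
    have der_U: "(U has_derivative DU p) (at p)" for p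
      using diffU by (simp add: DU_def frechet_derivative_works)
    \<comment> \<open>Along its own characteristic direction the network changes at the rate of its
      residual.\<close>
    have DU: "DU p (f (U p), 1) = \<epsilon>\<^sub>i p" for p
      using frechet_derivative_space_time[OF diffU] by (simp add: DU_def assms(14))

    \<comment> \<open>Sup-norm bounds for u and U\<close>
    have u_le: "\<bar>u (x, t)\<bar> \<le> r0" if "0 \<le> t" "t < T" for x t
    proof -
      \<comment> \<open>The solution has no source along its characteristic direction, so only the
        initial bound remains.\<close>
      have "\<bar>u (x, t)\<bar> \<le> r0 + t * 0"
      proof (rule transport_bound[where T = T and f = f and D = Du])
        show "continuous_on (UNIV \<times> {0..<T}) u"
          using contu by (rule continuous_on_subset) (auto simp: strip_def)
        show "\<bar>Du (x, t) (f (u (x, t)), 1)\<bar> \<le> 0" if "0 < t" "t < T" for x t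
          using pde[OF that, of x] by (simp add: Du[OF that] add.commute)
      qed (use f der_u u_0 u0_le that in auto)
      then show ?thesis
        by simp
    qed
    have U_le: "\<bar>U (x, t)\<bar> \<le> R" if "0 \<le> t" "t < T" for x t
    proof -
      \<comment> \<open>Here the source is the residual \<open>\<epsilon>\<^sub>i\<close>, and
        initially U = u0 + \<open>\<epsilon>\<^sub>b\<close>.\<close>
      have "\<bar>U (x, t)\<bar> \<le> (r0 + b) + t * \<epsilon>"
      proof (rule transport_bound[where T = T and f = f and D = DU])
        show "\<bar>U (x, 0)\<bar> \<le> r0 + b" for x
          using b_le[of x] u0_le[of x] by (simp add: assms(15))
      qed (use f der_U contU \<epsilon>_le \<epsilon> that in \<open>auto simp: DU\<close>)
      also have "\<dots> \<le> R"
        using that \<epsilon> by (simp add: R_def mult_right_mono)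
      finally show ?thesis .
    qed
    \<comment> \<open>With U bounded by R, a single V bounds the network speed f(U) for all x and
      all 0 < t < T, as the maximum principle requires.\<close>
    have "compact (f ` {-R..R})"
      by (intro compact_continuous_image continuous_on_subset[OF f]) auto
    then obtain V where V: "0 < V" "\<And>s. \<bar>s\<bar> \<le> R \<Longrightarrow> norm (f s) \<le> V"
      by (force dest!: compact_imp_bounded simp: bounded_pos abs_le_iff)
    have r1_nonneg: "0 \<le> r1"
      using \<rho>1 by (simp add: r1)

    \<comment> \<open>Bound of the error before the final time\<close>
    have e_le: "\<bar>U (x, t) - u (x, t)\<bar> \<le> (b + T * \<epsilon>) * exp (T * l * r1)"
      if t: "0 \<le> t" "t < T" for x t
    proof -
      \<comment> \<open>Both functions are differentiated along the network direction (f(U), 1). The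
        speed difference f(U) - f(u) then multiplies the gradient of u, which \<open>r1\<close>
        bounds, rather than that of U.\<close>
      have "\<bar>U (x, t) - u (x, t)\<bar> \<le> (b + t * \<epsilon>) * exp ((l * r1) * t)"
      proof (rule transport_difference_bound[where T = T and a = "\<lambda>p. f (U p)"
            and Du = Du and Dv = DU and V = V])
        show "continuous_on (UNIV \<times> {0..<T}) u"
          using contu by (rule continuous_on_subset) (auto simp: strip_def)
        show "\<bar>DU (x, t) (f (U (x, t)), 1) - Du (x, t) (f (U (x, t)), 1)\<bar>
          \<le> \<epsilon> + l * r1 * \<bar>U (x, t) - u (x, t)\<bar>" if t: "0 < t" "t < T" for x t
        proof -
          let ?d = "f (U (x, t)) - f (u (x, t))" and ?g = "grad_x (strip T) u (x, t)"
          \<comment> \<open>Both values lie in [-R, R]; the Lipschitz bound uses \<open>f'\<close>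
            only on (-R, R), where \<open>l\<close> bounds it since R <= r0 + R.\<close>
          have "norm ?d \<le> l * \<bar>U (x, t) - u (x, t)\<bar>"
            using U_le[of t x] u_le[of t x] t r0 R
            by (intro lipschitz_of_vector_derivative_bound[OF f'(1), where r = R] f'_le) auto
          then have "norm ?d * norm ?g \<le> (l * \<bar>U (x, t) - u (x, t)\<bar>) * r1"
            using l by (intro mult_mono grad_le t) auto
          then have "\<bar>?d \<bullet> ?g\<bar> \<le> l * r1 * \<bar>U (x, t) - u (x, t)\<bar>"
            using Cauchy_Schwarz_ineq2[of ?d ?g] by (simp add: mult_ac)
          \<comment> \<open>The equation for u replaces its time derivative by - f(u) . grad
            u.\<close>
          moreover have "DU (x, t) (f (U (x, t)), 1) - Du (x, t) (f (U (x, t)), 1)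
            = \<epsilon>\<^sub>i (x, t) - ?d \<bullet> ?g"
            using pde[OF t, of x] by (simp add: DU Du[OF t] inner_diff_left)
          ultimately show ?thesis
            using \<epsilon>_le[OF t, of x] by linarith
        qed
        show "\<bar>U (x, 0) - u (x, 0)\<bar> \<le> b" for x
          using b_le[of x] by (simp add: u_0 assms(15))
        show "norm (f (U (x, t))) \<le> V" if "0 < t" "t < T" for x t
          using U_le that by (intro V) auto
      qed (use contU der_u der_U \<epsilon> l V r1_nonneg t in auto)
      also have "\<dots> \<le> (b + T * \<epsilon>) * exp (T * l * r1)"
      proof (rule mult_mono)
        show "b + t * \<epsilon> \<le> b + T * \<epsilon>"
          using t \<epsilon> by (simp add: mult_right_mono)
        have "(l * r1) * t \<le> (l * r1) * T"
          using t l r1_nonneg by (intro mult_left_mono) auto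
        then show "exp ((l * r1) * t) \<le> exp (T * l * r1)"
          by (simp add: mult_ac)
      qed (use b \<epsilon> assms(6) in auto)
      finally show ?thesis .
    qed

    have "continuous_on (strip T) e"
      unfolding assms(16) by (intro continuous_intros contU contu)
    \<comment> \<open>The bound for t < T extends to the final time by continuity of
      \<open>e\<close>, since the half-open strip is dense in the closed one.\<close>
    moreover have closure: "closure (UNIV \<times> {0..<T}) = (strip T :: ((real ^ 'n) \<times> real) set)"
      using assms(6) by (simp add: closure_Times strip_def)
    ultimately have "norm (e p) \<le> (b + T * \<epsilon>) * exp (T * l * r1)" if "p \<in> strip T" for p
      using that e_le
      by (intro continuous_on_closure_norm_le[of "UNIV \<times> {0..<T}"]) (auto simp: assms(16))
    then have "Linf_norm (strip T) e \<le> ereal ((b + T * \<epsilon>) * exp (T * l * r1))"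
      using b \<epsilon> assms(6) \<open>continuous_on (strip T) e\<close> by (intro Linf_norm_leI strip) auto
    then show ?thesis
      by (simp add: b \<epsilon> l r1 exp_ereal_def)
  qed
qed

end
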